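(* Let $p$ be a prime, let $d,n\ge 1$ be integers, and let $\theta\in[0,2\pi)$. Let $\{\tau_j\}_{j=1}^n$ be a p-adic $(d,n,\theta)$-spherical code in $\mathbb{Q}_p^d$. Let $c>0$ be a real number and let $\phi:[0,\infty)\to\mathbb{R}$ be a function satisfying the following two conditions: (i) $\sum_{1\le j,k\le n}\phi\big(|2-2\langle \tau_j,\tau_k\rangle|\big)\ge 0$, where the sum is over all ordered pairs $(j,k)$, including $j=k$; (ii) $\phi(r)+c\le 0$ for all real $r\in[2(1-\cos\theta),\infty)$. Then $$n\le \frac{\phi(0)+c}{c}.$$ In particular, if $\phi(0)+c\le 1$, then $n\le 1/c$.
   Context: $|\cdot|$ denotes the (standard, real-valued) p-adic absolute value on the field $\mathbb{Q}_p$ of p-adic numbers. The space $\mathbb{Q}_p^d$ carries the p-adic inner product $\langle (a_j)_{j=1}^d,(b_j)_{j=1}^d\rangle=\sum_{j=1}^d a_jb_j\in\mathbb{Q}_p$ and the norm $\|(x_j)_{j=1}^d\|=\max_{1\le j\le d}|x_j|$. Definition. For $d\in\mathbb{N}$ and $\theta\in[0,2\pi)$, vectors $\{\tau_j\}_{j=1}^n$ in $\mathbb{Q}_p^d$ form a p-adic $(d,n,\theta)$-spherical code in $\mathbb{Q}_p^d$ if: (i) $\|\tau_j\|=1$ for all $1\le j\le n$; (ii) $\langle\tau_j,\tau_j\rangle=1$ for all $1\le j\le n$; (iii) $|2-2\langle\tau_j,\tau_k\rangle|\ge 2(1-\cos\theta)$ for all $1\le j,k\le n$ with $j\ne k$ (an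 inequality of real numbers). *)

theory Defs
  imports
    Complex_Main
    "HOL-Computational_Algebra.Primes"
    "HOL-Library.FuncSet"
    "HOL-Algebra.QuotRing"
begin

section \<open>The p-adic absolute value on the rationals\<close>

definition rat_padic_val :: "nat \<Rightarrow> rat \<Rightarrow> int" where
  "rat_padic_val p x =
     int (multiplicity (int p) (fst (quotient_of x))) - int (multiplicity (int p) (snd (quotient_of x)))"

definition rat_padic_abs :: "nat \<Rightarrow> rat \<Rightarrow> real" where
  "rat_padic_abs p x = (if x = 0 then 0 else real p powi (- rat_padic_val p x))"


lemma rat_padic_val_frac:
  assumes p: "prime p" and a: "a \<noteq> 0" and b: "b \<noteq> 0"
  shows "rat_padic_val p (of_int a / of_int b) = int (multiplicity (int p) a) - int (multiplicity (int p) b)"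
proof -
  define x :: rat where "x = of_int a / of_int b"
  obtain u v where q: "quotient_of x = (u, v)" by force
  have v: "v > 0" using quotient_of_denom_pos[OF q] .
  have x: "x = of_int u / of_int v" by (rule quotient_of_div[OF q])
  have "(of_int (a * v) :: rat) = of_int (u * b)"
    using x b v unfolding x_def by (simp add: field_simps)
  hence e: "a * v = u * b" by (simp only: of_int_eq_iff)
  have u: "u \<noteq> 0" using e a v by auto
  have pe: "prime_elem (int p)" using p by simp
  have "multiplicity (int p) a + multiplicity (int p) v = multiplicity (int p) u + multiplicity (int p) b"
    using e prime_elem_multiplicity_mult_distrib[OF pe a, of v]
      prime_elem_multiplicity_mult_distrib[OF pe u b] v by simp
  thus ?thesis unfolding x_def[symmetric] rat_padic_val_def q by simp
qed

lemma rat_frac: obtains a b where "(x::rat) = of_int a / of_int b" "b \<noteq> 0"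
  by (metis quotient_of_div quotient_of_denom_pos less_irrefl surj_pair)

lemma rat_padic_val_mult:
  assumes p: "prime p" and x: "x \<noteq> 0" and y: "y \<noteq> 0"
  shows "rat_padic_val p (x * y) = rat_padic_val p x + rat_padic_val p y"
proof -
  obtain a b where x': "x = of_int a / of_int b" "b \<noteq> 0" by (rule rat_frac)
  obtain c d where y': "y = of_int c / of_int d" "d \<noteq> 0" by (rule rat_frac)
  have n: "a \<noteq> 0" "c \<noteq> 0" using x y x' y' by auto
  have pe: "prime_elem (int p)" using p by simp
  have e: "x * y = of_int (a * c) / of_int (b * d)" unfolding x' y' by simp
  have "a * c \<noteq> 0" "b * d \<noteq> 0" using n x' y' by auto
  from rat_padic_val_frac[OF p this] show ?thesis unfolding e
    unfolding x' y' rat_padic_val_frac[OF p n(1) x'(2)] rat_padic_val_frac[OF p n(2) y'(2)]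
      prime_elem_multiplicity_mult_distrib[OF pe n] prime_elem_multiplicity_mult_distrib[OF pe x'(2) y'(2)]
    by simp
qed

lemma rat_padic_val_add:
  assumes p: "prime p" and x: "x \<noteq> 0" and y: "y \<noteq> 0" and xy: "x + y \<noteq> 0"
  shows "rat_padic_val p (x + y) \<ge> min (rat_padic_val p x) (rat_padic_val p y)"
proof -
  obtain a b where x': "x = of_int a / of_int b" "b \<noteq> 0" by (rule rat_frac)
  obtain c d where y': "y = of_int c / of_int d" "d \<noteq> 0" by (rule rat_frac)
  let ?m = "multiplicity (int p)"
  have pe: "prime_elem (int p)" using p by simp
  have e: "x + y = of_int (a * d + c * b) / of_int (b * d)"
    unfolding x' y' using x' y' by (simp add: field_simps)
  have n: "a * d \<noteq> 0" "c * b \<noteq> 0" "b * d \<noteq> 0" using x y x' y' by auto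
  have s: "a * d + c * b \<noteq> 0" using e xy by (metis div_0 of_int_0)
  have ex: "x = of_int (a * d) / of_int (b * d)" "y = of_int (c * b) / of_int (b * d)"
    unfolding x' y' using x' y' by (simp_all add: field_simps)
  have "?m (a * d + c * b) \<ge> min (?m (a * d)) (?m (c * b))"
  proof (rule multiplicity_geI)
    show "int p ^ min (?m (a * d)) (?m (c * b)) dvd a * d + c * b"
      by (intro dvd_add multiplicity_dvd') simp_all
  qed (use s pe in auto)
  thus ?thesis
    using rat_padic_val_frac[OF p n(1) n(3)] rat_padic_val_frac[OF p n(2) n(3)]
      rat_padic_val_frac[OF p s n(3)] unfolding e[symmetric] ex[symmetric] by linarith
qed

lemma rat_padic_abs_0 [simp]: "rat_padic_abs p 0 = 0"
  by (simp add: rat_padic_abs_def)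

lemma rat_padic_abs_1 [simp]: "rat_padic_abs p 1 = 1"
  by (simp add: rat_padic_abs_def rat_padic_val_def)

lemma rat_padic_abs_nonneg [simp]: "rat_padic_abs p x \<ge> 0"
  by (simp add: rat_padic_abs_def)

lemma rat_padic_abs_eq_0_iff: "prime p \<Longrightarrow> rat_padic_abs p x = 0 \<longleftrightarrow> x = 0"
  by (auto simp: rat_padic_abs_def)

lemma rat_padic_abs_mult:
  "prime p \<Longrightarrow> rat_padic_abs p (x * y) = rat_padic_abs p x * rat_padic_abs p y"
  by (auto simp: rat_padic_abs_def rat_padic_val_mult power_int_add
      dest: prime_gt_0_nat simp flip: power_int_add)

lemma rat_padic_abs_add:
  assumes "prime p"
  shows "rat_padic_abs p (x + y) \<le> max (rat_padic_abs p x) (rat_padic_abs p y)"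
proof (cases "x = 0 \<or> y = 0 \<or> x + y = 0")
  case True
  thus ?thesis by (auto simp: le_max_iff_disj)
next
  case False
  have p: "real p \<ge> 1" using prime_gt_0_nat[OF assms] by simp
  from rat_padic_val_add[OF assms, of x y] False
  have "rat_padic_val p x \<le> rat_padic_val p (x + y) \<or> rat_padic_val p y \<le> rat_padic_val p (x + y)"
    by auto
  thus ?thesis using False p
    by (auto simp: rat_padic_abs_def le_max_iff_disj intro!: power_int_increasing)
qed

lemma rat_padic_abs_minus [simp]: "rat_padic_abs p (- x) = rat_padic_abs p x"
proof -
  have "rat_padic_val p (- x) = rat_padic_val p x"
    by (simp add: rat_padic_val_def rat_uminus_code Let_def multiplicity_def split: prod.split)
  thus ?thesis by (simp add: rat_padic_abs_def)
qed

lemma rat_padic_abs_prime: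
  assumes "prime p" shows "rat_padic_abs p (of_nat p) = 1 / real p"
proof -
  have "rat_padic_val p (of_int (int p) / of_int 1) = 1"
    using assms by (subst rat_padic_val_frac) (auto simp: multiplicity_self prime_gt_0_nat)
  thus ?thesis using assms by (simp add: rat_padic_abs_def power_int_minus field_simps)
qed

lemma rat_padic_abs_triangle:
  "prime p \<Longrightarrow> rat_padic_abs p (x + y) \<le> rat_padic_abs p x + rat_padic_abs p y"
  using rat_padic_abs_add[of p x y] rat_padic_abs_nonneg[of p x] rat_padic_abs_nonneg[of p y]
  by linarith

lemma rat_padic_abs_minus_commute: "rat_padic_abs p (x - y) = rat_padic_abs p (y - x)"
  by (metis minus_diff_eq rat_padic_abs_minus)

lemma rat_padic_abs_triangle_rev:
  "prime p \<Longrightarrow> \<bar>rat_padic_abs p x - rat_padic_abs p y\<bar> \<le> rat_padic_abs p (x - y)"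
  using rat_padic_abs_triangle[of p "x - y" y] rat_padic_abs_triangle[of p "y - x" x]
    rat_padic_abs_minus_commute[of p x y] by simp


section \<open>The field of p-adic numbers\<close>

text \<open>
  The field of p-adic numbers is the completion of the rationals: the ring of p-adic Cauchy
  sequences of rationals modulo the ideal of p-adic null sequences.
  A p-adic number is thus a set of rational sequences.
\<close>

type_synonym padic = "(nat \<Rightarrow> rat) set"

definition padic_Cauchy :: "nat \<Rightarrow> (nat \<Rightarrow> rat) set" where
  "padic_Cauchy p =
     {x. \<forall>e>0. \<exists>N. \<forall>m\<ge>N. \<forall>n\<ge>N. rat_padic_abs p (x m - x n) < e}"

definition padic_null :: "nat \<Rightarrow> (nat \<Rightarrow> rat) set" where
  "padic_null p = {x. (\<lambda>n. rat_padic_abs p (x n)) \<longlonglongrightarrow> 0}"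

definition padic_Cauchy_ring :: "nat \<Rightarrow> (nat \<Rightarrow> rat) ring" where
  "padic_Cauchy_ring p =
     \<lparr>carrier = padic_Cauchy p, mult = (\<lambda>x y n. x n * y n), one = (\<lambda>n. 1),
      zero = (\<lambda>n. 0), add = (\<lambda>x y n. x n + y n)\<rparr>"

definition Qp :: "nat \<Rightarrow> padic ring" where
  "Qp p = padic_Cauchy_ring p Quot padic_null p"

definition padic_abs :: "nat \<Rightarrow> padic \<Rightarrow> real" where
  "padic_abs p X = (THE r. \<forall>x\<in>X. (\<lambda>n. rat_padic_abs p (x n)) \<longlonglongrightarrow> r)"


lemma padic_CauchyD:
  "x \<in> padic_Cauchy p \<Longrightarrow> e > 0 \<Longrightarrow> \<exists>N. \<forall>m\<ge>N. \<forall>n\<ge>N. rat_padic_abs p (x m - x n) < e"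
  by (auto simp: padic_Cauchy_def)

lemma padic_Cauchy_convergent:
  assumes "prime p" and "x \<in> padic_Cauchy p"
  shows "convergent (\<lambda>n. rat_padic_abs p (x n))"
proof -
  have "Cauchy (\<lambda>n. rat_padic_abs p (x n))"
  proof (rule CauchyI)
    fix e :: real assume "e > 0"
    then obtain N where "\<forall>m\<ge>N. \<forall>n\<ge>N. rat_padic_abs p (x m - x n) < e"
      using padic_CauchyD[OF assms(2)] by blast
    hence "norm (rat_padic_abs p (x m) - rat_padic_abs p (x n)) < e" if "m \<ge> N" "n \<ge> N" for m n
      using rat_padic_abs_triangle_rev[OF assms(1), of "x m" "x n"] that
      by (simp add: order_le_less_trans)
    thus "\<exists>M. \<forall>m\<ge>M. \<forall>n\<ge>M. norm (rat_padic_abs p (x m) - rat_padic_abs p (x n)) < e" by blast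
  qed
  thus ?thesis by (rule Cauchy_convergent)
qed

lemma padic_Cauchy_bounded:
  assumes "prime p" and "x \<in> padic_Cauchy p"
  shows "\<exists>B>0. \<forall>n. rat_padic_abs p (x n) \<le> B"
proof -
  have "Bseq (\<lambda>n. rat_padic_abs p (x n))"
    by (rule convergent_imp_Bseq[OF padic_Cauchy_convergent[OF assms]])
  thus ?thesis by (simp add: Bseq_def)
qed

lemma padic_Cauchy_const: "(\<lambda>n. c) \<in> padic_Cauchy p"
  by (simp add: padic_Cauchy_def)

lemma padic_Cauchy_minus: "x \<in> padic_Cauchy p \<Longrightarrow> (\<lambda>n. - x n) \<in> padic_Cauchy p"
proof -
  have "rat_padic_abs p (- x m - - x n) = rat_padic_abs p (x m - x n)" for m n
    using rat_padic_abs_minus_commute[of p "x n" "x m"] by simp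
  thus "x \<in> padic_Cauchy p \<Longrightarrow> (\<lambda>n. - x n) \<in> padic_Cauchy p" by (simp only: padic_Cauchy_def mem_Collect_eq)
qed

lemma padic_Cauchy_add:
  assumes p: "prime p" and x: "x \<in> padic_Cauchy p" and y: "y \<in> padic_Cauchy p"
  shows "(\<lambda>n. x n + y n) \<in> padic_Cauchy p"
  unfolding padic_Cauchy_def
proof (intro CollectI allI impI)
  fix e :: real assume e: "e > 0"
  obtain M where M: "\<forall>m\<ge>M. \<forall>n\<ge>M. rat_padic_abs p (x m - x n) < e" using padic_CauchyD[OF x e] by blast
  obtain N where N: "\<forall>m\<ge>N. \<forall>n\<ge>N. rat_padic_abs p (y m - y n) < e" using padic_CauchyD[OF y e] by blast
  have "rat_padic_abs p (x m + y m - (x n + y n)) < e" if "m \<ge> max M N" "n \<ge> max M N" for m n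
  proof -
    have "rat_padic_abs p (x m - x n) < e" "rat_padic_abs p (y m - y n) < e" using M N that by auto
    thus ?thesis using rat_padic_abs_add[OF p, of "x m - x n" "y m - y n"]
      by (simp add: add_diff_add)
  qed
  thus "\<exists>N. \<forall>m\<ge>N. \<forall>n\<ge>N. rat_padic_abs p (x m + y m - (x n + y n)) < e" by blast
qed

lemma padic_Cauchy_mult:
  assumes p: "prime p" and x: "x \<in> padic_Cauchy p" and y: "y \<in> padic_Cauchy p"
  shows "(\<lambda>n. x n * y n) \<in> padic_Cauchy p"
  unfolding padic_Cauchy_def
proof (intro CollectI allI impI)
  fix e :: real assume e: "e > 0"
  obtain A where A: "A > 0" "\<And>n. rat_padic_abs p (x n) \<le> A" using padic_Cauchy_bounded[OF p x] by blast
  obtain B where B: "B > 0" "\<And>n. rat_padic_abs p (y n) \<le> B" using padic_Cauchy_bounded[OF p y] by blast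
  have "e / B > 0" "e / A > 0" using e A B by auto
  then obtain M N where M: "\<forall>m\<ge>M. \<forall>n\<ge>M. rat_padic_abs p (x m - x n) < e / B"
    and N: "\<forall>m\<ge>N. \<forall>n\<ge>N. rat_padic_abs p (y m - y n) < e / A"
    using padic_CauchyD[OF x] padic_CauchyD[OF y] by meson
  have "rat_padic_abs p (x m * y m - x n * y n) < e" if mn: "m \<ge> max M N" "n \<ge> max M N" for m n
  proof -
    have "rat_padic_abs p (x m * (y m - y n)) \<le> A * rat_padic_abs p (y m - y n)"
      using A by (simp add: rat_padic_abs_mult[OF p] mult_right_mono)
    also have "\<dots> < e" using N mn A by (simp add: field_simps)
    finally have 1: "rat_padic_abs p (x m * (y m - y n)) < e" .
    have "rat_padic_abs p ((x m - x n) * y n) \<le> rat_padic_abs p (x m - x n) * B"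
      using B by (simp add: rat_padic_abs_mult[OF p] mult_left_mono)
    also have "\<dots> < e" using M mn B by (simp add: field_simps)
    finally have 2: "rat_padic_abs p ((x m - x n) * y n) < e" .
    have "x m * y m - x n * y n = x m * (y m - y n) + (x m - x n) * y n" by (simp add: algebra_simps)
    with 1 2 rat_padic_abs_add[OF p, of "x m * (y m - y n)" "(x m - x n) * y n"] show ?thesis by simp
  qed
  thus "\<exists>N. \<forall>m\<ge>N. \<forall>n\<ge>N. rat_padic_abs p (x m * y m - x n * y n) < e" by blast
qed

lemma padic_null_subset:
  assumes p: "prime p" shows "padic_null p \<subseteq> padic_Cauchy p"
proof
  fix x assume "x \<in> padic_null p"
  hence lim: "(\<lambda>n. rat_padic_abs p (x n)) \<longlonglongrightarrow> 0" by (simp add: padic_null_def)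
  show "x \<in> padic_Cauchy p" unfolding padic_Cauchy_def
  proof (intro CollectI allI impI)
    fix e :: real assume "e > 0"
    then obtain N where N: "\<forall>n\<ge>N. rat_padic_abs p (x n) < e"
      using LIMSEQ_D[OF lim] by auto
    have "rat_padic_abs p (x m - x n) < e" if "m \<ge> N" "n \<ge> N" for m n
    proof -
      have "rat_padic_abs p (x m) < e" "rat_padic_abs p (x n) < e" using N that by auto
      thus ?thesis using rat_padic_abs_add[OF p, of "x m" "- x n"] by simp
    qed
    thus "\<exists>N. \<forall>m\<ge>N. \<forall>n\<ge>N. rat_padic_abs p (x m - x n) < e" by blast
  qed
qed

lemma padic_null_add:
  assumes p: "prime p" and "x \<in> padic_null p" "y \<in> padic_null p"
  shows "(\<lambda>n. x n + y n) \<in> padic_null p"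
proof -
  have "(\<lambda>n. rat_padic_abs p (x n) + rat_padic_abs p (y n)) \<longlonglongrightarrow> 0"
    using tendsto_add[of "\<lambda>n. rat_padic_abs p (x n)" 0 sequentially "\<lambda>n. rat_padic_abs p (y n)" 0] assms
    by (simp add: padic_null_def)
  thus ?thesis unfolding padic_null_def mem_Collect_eq
    by (rule tendsto_0_le[where K = 1]) (simp add: rat_padic_abs_triangle[OF p])
qed

lemma padic_null_mult:
  assumes p: "prime p" and x: "x \<in> padic_Cauchy p" and y: "y \<in> padic_null p"
  shows "(\<lambda>n. x n * y n) \<in> padic_null p"
proof -
  obtain l where "(\<lambda>n. rat_padic_abs p (x n)) \<longlonglongrightarrow> l"
    using padic_Cauchy_convergent[OF p x] by (auto simp: convergent_def)
  from tendsto_mult[OF this, of _ 0] y show ?thesis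
    by (simp add: padic_null_def rat_padic_abs_mult[OF p])
qed

lemma padic_Cauchy_ring_simps:
  "carrier (padic_Cauchy_ring p) = padic_Cauchy p"
  "x \<otimes>\<^bsub>padic_Cauchy_ring p\<^esub> y = (\<lambda>n. x n * y n)"
  "x \<oplus>\<^bsub>padic_Cauchy_ring p\<^esub> y = (\<lambda>n. x n + y n)"
  "\<one>\<^bsub>padic_Cauchy_ring p\<^esub> = (\<lambda>n. 1)"
  "\<zero>\<^bsub>padic_Cauchy_ring p\<^esub> = (\<lambda>n. 0)"
  by (simp_all add: padic_Cauchy_ring_def)

lemma padic_Cauchy_ring_cring: assumes p: "prime p" shows "cring (padic_Cauchy_ring p)"
proof (rule cringI)
  show "abelian_group (padic_Cauchy_ring p)"
  proof (rule abelian_groupI, unfold padic_Cauchy_ring_simps)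
    show "\<exists>y\<in>padic_Cauchy p. (\<lambda>n. y n + x n) = (\<lambda>n. 0)" if "x \<in> padic_Cauchy p" for x
      by (rule bexI[OF _ padic_Cauchy_minus[OF that]]) simp
  qed (simp_all add: padic_Cauchy_add[OF p] padic_Cauchy_const add.assoc, simp add: add.commute)
  show "Group.comm_monoid (padic_Cauchy_ring p)"
    by (rule comm_monoidI, unfold padic_Cauchy_ring_simps)
       (simp_all add: padic_Cauchy_mult[OF p] padic_Cauchy_const mult.assoc, simp add: mult.commute)
qed (simp add: padic_Cauchy_ring_simps distrib_right)

lemma padic_null_ideal: assumes p: "prime p" shows "ideal (padic_null p) (padic_Cauchy_ring p)"
proof -
  interpret R: cring "padic_Cauchy_ring p" by (rule padic_Cauchy_ring_cring[OF p])
  have carr: "carrier (padic_Cauchy_ring p) = padic_Cauchy p" by (simp add: padic_Cauchy_ring_def)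
  have minus: "\<ominus>\<^bsub>padic_Cauchy_ring p\<^esub> x = (\<lambda>n. - x n)" if "x \<in> padic_Cauchy p" for x
    by (rule R.minus_equality)
       (use that in \<open>auto simp: padic_Cauchy_ring_def padic_Cauchy_minus\<close>)
  show ?thesis
  proof (rule idealI)
    show "ring (padic_Cauchy_ring p)" by (rule R.ring_axioms)
    show "subgroup (padic_null p) (add_monoid (padic_Cauchy_ring p))"
    proof (rule R.add.subgroupI)
      show "padic_null p \<subseteq> carrier (padic_Cauchy_ring p)" using padic_null_subset[OF p] by (simp add: carr)
      have "(\<lambda>n. 0) \<in> padic_null p" by (simp add: padic_null_def)
      thus "padic_null p \<noteq> {}" by blast
      show "\<ominus>\<^bsub>padic_Cauchy_ring p\<^esub> a \<in> padic_null p" if "a \<in> padic_null p" for a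
        using that minus[of a] padic_null_subset[OF p] by (auto simp: padic_null_def)
      show "a \<oplus>\<^bsub>padic_Cauchy_ring p\<^esub> b \<in> padic_null p" if "a \<in> padic_null p" "b \<in> padic_null p" for a b
        using padic_null_add[OF p that] by (simp add: padic_Cauchy_ring_def)
    qed
  next
    fix a x assume a: "a \<in> padic_null p" and x: "x \<in> carrier (padic_Cauchy_ring p)"
    have "(\<lambda>n. x n * a n) \<in> padic_null p" using padic_null_mult[OF p _ a] x by (simp add: carr)
    thus "x \<otimes>\<^bsub>padic_Cauchy_ring p\<^esub> a \<in> padic_null p" "a \<otimes>\<^bsub>padic_Cauchy_ring p\<^esub> x \<in> padic_null p"
      by (simp_all add: padic_Cauchy_ring_def mult.commute)
  qed
qed

lemma padic_abs_coset:
  assumes p: "prime p" and x: "x \<in> padic_Cauchy p"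
  shows "(\<lambda>n. rat_padic_abs p (x n)) \<longlonglongrightarrow> padic_abs p (padic_null p +>\<^bsub>padic_Cauchy_ring p\<^esub> x)"
proof -
  let ?X = "padic_null p +>\<^bsub>padic_Cauchy_ring p\<^esub> x"
  interpret ideal "padic_null p" "padic_Cauchy_ring p" by (rule padic_null_ideal[OF p])
  obtain l where l: "(\<lambda>n. rat_padic_abs p (x n)) \<longlonglongrightarrow> l"
    using padic_Cauchy_convergent[OF p x] by (auto simp: convergent_def)
  have xX: "x \<in> ?X" using a_rcos_self x by (simp add: padic_Cauchy_ring_def)
  have all: "(\<lambda>n. rat_padic_abs p (y n)) \<longlonglongrightarrow> l" if "y \<in> ?X" for y
  proof -
    from that obtain z where z: "z \<in> padic_null p" "y = (\<lambda>n. z n + x n)"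
      by (auto simp: a_r_coset_def' padic_Cauchy_ring_def)
    have "(\<lambda>n. rat_padic_abs p (y n) - rat_padic_abs p (x n)) \<longlonglongrightarrow> 0"
    proof (rule tendsto_0_le[where K = 1])
      show "(\<lambda>n. rat_padic_abs p (z n)) \<longlonglongrightarrow> 0" using z by (simp add: padic_null_def)
      have "\<bar>rat_padic_abs p (y n) - rat_padic_abs p (x n)\<bar> \<le> rat_padic_abs p (z n)" for n
        using rat_padic_abs_triangle_rev[OF p, of "y n" "x n"] z by simp
      thus "\<forall>\<^sub>F n in sequentially. norm (rat_padic_abs p (y n) - rat_padic_abs p (x n))
              \<le> norm (rat_padic_abs p (z n)) * 1" by simp
    qed
    from tendsto_add[OF this l] show ?thesis by simp
  qed
  have "padic_abs p ?X = l" unfolding padic_abs_def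
  proof (rule the_equality)
    show "\<forall>y\<in>?X. (\<lambda>n. rat_padic_abs p (y n)) \<longlonglongrightarrow> l" using all by blast
  next
    fix r assume "\<forall>y\<in>?X. (\<lambda>n. rat_padic_abs p (y n)) \<longlonglongrightarrow> r"
    with xX show "r = l" using LIMSEQ_unique[OF _ l] by blast
  qed
  with l show ?thesis by simp
qed

lemma carrier_Qp: "carrier (Qp p) = (\<lambda>x. padic_null p +>\<^bsub>padic_Cauchy_ring p\<^esub> x) ` padic_Cauchy p"
proof -
  have "carrier (padic_Cauchy_ring p) = padic_Cauchy p" by (simp add: padic_Cauchy_ring_def)
  thus ?thesis by (simp add: Qp_def FactRing_def A_RCOSETS_def' UNION_singleton_eq_range)
qed

lemma Qp_field: assumes p: "prime p" shows "field (Qp p)"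
proof -
  let ?I = "padic_null p" and ?R = "padic_Cauchy_ring p"
  interpret R: cring ?R by (rule padic_Cauchy_ring_cring[OF p])
  interpret I: ideal ?I ?R by (rule padic_null_ideal[OF p])
  interpret Q: cring "Qp p" unfolding Qp_def by (rule I.quotient_is_cring[OF R.is_cring])
  have carr: "carrier ?R = padic_Cauchy p" by (simp add: padic_Cauchy_ring_def)
  have eq: "?I +>\<^bsub>?R\<^esub> x = ?I +>\<^bsub>?R\<^esub> y" if "(\<lambda>n. x n - y n) \<in> ?I" "y \<in> padic_Cauchy p" for x y
  proof (rule I.a_repr_independence'[symmetric])
    show "x \<in> ?I +>\<^bsub>?R\<^esub> y" using that
      by (auto simp: a_r_coset_def' padic_Cauchy_ring_def intro!: bexI[of _ "\<lambda>n. x n - y n"])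
  qed (use that carr in auto)
  show ?thesis
  proof (rule Q.cring_fieldI2)
    have "(\<lambda>n. 1) \<notin> ?I" by (simp add: padic_null_def LIMSEQ_const_iff)
    moreover have "(\<lambda>n. 1) \<in> ?I +>\<^bsub>?R\<^esub> (\<lambda>n. 1)"
      using I.a_rcos_self[of "\<lambda>n. 1"] by (simp add: carr padic_Cauchy_const)
    ultimately show "\<zero>\<^bsub>Qp p\<^esub> \<noteq> \<one>\<^bsub>Qp p\<^esub>"
      by (auto simp: Qp_def FactRing_def padic_Cauchy_ring_def)
  next
    fix X assume "X \<in> carrier (Qp p)" and nz: "X \<noteq> \<zero>\<^bsub>Qp p\<^esub>"
    then obtain x where x: "x \<in> padic_Cauchy p" and X: "X = ?I +>\<^bsub>?R\<^esub> x" by (auto simp: carrier_Qp)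
    have "x \<notin> ?I" using nz X I.a_rcos_const by (auto simp: Qp_def FactRing_def)
    obtain l where l: "(\<lambda>n. rat_padic_abs p (x n)) \<longlonglongrightarrow> l"
      using padic_Cauchy_convergent[OF p x] by (auto simp: convergent_def)
    have "l \<noteq> 0" using l \<open>x \<notin> ?I\<close> by (auto simp: padic_null_def)
    moreover have "l \<ge> 0" using l by (rule LIMSEQ_le_const) auto
    ultimately have l0: "l > 0" by simp
    then obtain N where N: "\<And>n. n \<ge> N \<Longrightarrow> rat_padic_abs p (x n) > l / 2"
      using order_tendstoD(1)[OF l, of "l / 2"] by (auto simp: eventually_sequentially)
    have x0: "x n \<noteq> 0" if "n \<ge> N" for n using N[OF that] l0 by auto
    define y where "y = (\<lambda>n. inverse (x n))"
    have y: "y \<in> padic_Cauchy p" unfolding padic_Cauchy_def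
    proof (intro CollectI allI impI)
      fix e :: real assume e: "e > 0"
      hence "e * (l / 2 * (l / 2)) > 0" using l0 by simp
      from padic_CauchyD[OF x this] obtain M where
        M: "\<forall>m\<ge>M. \<forall>n\<ge>M. rat_padic_abs p (x m - x n) < e * (l / 2 * (l / 2))" by blast
      have "rat_padic_abs p (y m - y n) < e" if mn: "m \<ge> max M N" "n \<ge> max M N" for m n
      proof -
        have "(y m - y n) * (x m * x n) = x n - x m"
          using x0[of m] x0[of n] mn by (simp add: y_def field_simps)
        hence "rat_padic_abs p (y m - y n) * (rat_padic_abs p (x m) * rat_padic_abs p (x n))
               = rat_padic_abs p (x m - x n)"
          by (metis rat_padic_abs_mult[OF p] rat_padic_abs_minus_commute)
        also have "\<dots> < e * (l / 2 * (l / 2))" using M mn by simp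
        also have "\<dots> \<le> e * (rat_padic_abs p (x m) * rat_padic_abs p (x n))"
          using N[of m] N[of n] mn l0 e by (intro mult_left_mono mult_mono) auto
        finally show ?thesis by (simp add: mult_less_cancel_right)
      qed
      thus "\<exists>N. \<forall>m\<ge>N. \<forall>n\<ge>N. rat_padic_abs p (y m - y n) < e" by blast
    qed
    have "\<forall>\<^sub>F n in sequentially. rat_padic_abs p (x n * y n - 1) = 0"
      using x0 by (auto simp: eventually_sequentially y_def intro!: exI[of _ N])
    hence null: "(\<lambda>n. x n * y n - 1) \<in> ?I" unfolding padic_null_def
      by (simp add: tendsto_eventually)
    have "X \<otimes>\<^bsub>Qp p\<^esub> (?I +>\<^bsub>?R\<^esub> y) = ?I +>\<^bsub>?R\<^esub> (\<lambda>n. x n * y n)"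
      using I.rcoset_mult_add[of x y] x y by (simp add: X Qp_def FactRing_def carr) (simp add: padic_Cauchy_ring_def)
    also have "\<dots> = ?I +>\<^bsub>?R\<^esub> (\<lambda>n. 1)" by (rule eq[OF null padic_Cauchy_const])
    also have "\<dots> = \<one>\<^bsub>Qp p\<^esub>" by (simp add: Qp_def FactRing_def padic_Cauchy_ring_def)
    finally show "\<exists>Y\<in>carrier (Qp p). X \<otimes>\<^bsub>Qp p\<^esub> Y = \<one>\<^bsub>Qp p\<^esub>" using y by (auto simp: carrier_Qp)
  qed
qed

lemma padic_abs_of_rat:
  assumes p: "prime p"
  shows "padic_abs p (padic_null p +>\<^bsub>padic_Cauchy_ring p\<^esub> (\<lambda>n. c)) = rat_padic_abs p c"
  using padic_abs_coset[OF p padic_Cauchy_const[of c p]] by (simp add: LIMSEQ_const_iff)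


section \<open>The space of p-adic vectors\<close>

text \<open>Vectors are functions on the index set \<open>{1..d}\<close>, undefined outside it.\<close>

definition padic_space :: "nat \<Rightarrow> nat \<Rightarrow> (nat \<Rightarrow> padic) set" where
  "padic_space p d = {1..d} \<rightarrow>\<^sub>E carrier (Qp p)"

definition padic_inner ::
  "nat \<Rightarrow> nat \<Rightarrow> (nat \<Rightarrow> padic) \<Rightarrow> (nat \<Rightarrow> padic) \<Rightarrow> padic" where
  "padic_inner p d a b = (\<Oplus>\<^bsub>Qp p\<^esub>i\<in>{1..d}. a i \<otimes>\<^bsub>Qp p\<^esub> b i)"

definition padic_norm :: "nat \<Rightarrow> nat \<Rightarrow> (nat \<Rightarrow> padic) \<Rightarrow> real" where
  "padic_norm p d x = Max ((\<lambda>i. padic_abs p (x i)) ` {1..d})"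

definition abs_two_minus_two_inner ::
  "nat \<Rightarrow> nat \<Rightarrow> (nat \<Rightarrow> padic) \<Rightarrow> (nat \<Rightarrow> padic) \<Rightarrow> real" where
  "abs_two_minus_two_inner p d a b =
     padic_abs p (([(2::nat)] \<cdot>\<^bsub>Qp p\<^esub> \<one>\<^bsub>Qp p\<^esub>)
                    \<ominus>\<^bsub>Qp p\<^esub> ([(2::nat)] \<cdot>\<^bsub>Qp p\<^esub> padic_inner p d a b))"

definition padic_spherical_code ::
  "nat \<Rightarrow> nat \<Rightarrow> nat \<Rightarrow> real \<Rightarrow> (nat \<Rightarrow> nat \<Rightarrow> padic) \<Rightarrow> bool" where
  "padic_spherical_code p d n \<theta> \<tau> \<longleftrightarrow>
     (\<forall>j\<in>{1..n}. \<tau> j \<in> padic_space p d) \<and>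
     (\<forall>j\<in>{1..n}. padic_norm p d (\<tau> j) = 1) \<and>
     (\<forall>j\<in>{1..n}. padic_inner p d (\<tau> j) (\<tau> j) = \<one>\<^bsub>Qp p\<^esub>) \<and>
     (\<forall>j\<in>{1..n}. \<forall>k\<in>{1..n}. j \<noteq> k \<longrightarrow>
        abs_two_minus_two_inner p d (\<tau> j) (\<tau> k) \<ge> 2 * (1 - cos \<theta>))"

end

theory Submission
  imports Defs
begin

text \<open>
  This is the linear programming bound of Delsarte in its simplest form, a double count of
  the sum of \<open>\<phi> \<bar>2 - 2\<langle>\<tau> j, \<tau> k\<rangle>\<bar>\<close> over all ordered pairs. The hypothesis makes the sum
  nonnegative. On the other hand, each of the \<open>n\<close> diagonal pairs contributes \<open>\<phi> 0\<close>, because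
  \<open>\<langle>\<tau> j, \<tau> j\<rangle> = 1\<close>, and each of the \<open>n (n - 1)\<close> other pairs contributes at most \<open>- c\<close>, because
  the code separates its vectors into the range where \<open>\<phi> + c \<le> 0\<close>. Hence
  \<open>0 \<le> n (\<phi> 0 - (n - 1) c)\<close>, and dividing by \<open>n\<close> and by \<open>c\<close> gives the bound.

  The counting argument concerns an arbitrary real kernel on a finite set
  (\<open>card_le_of_sum_kernel_nonneg\<close>). The p-adic numbers enter only through the value of the
  kernel on the diagonal (\<open>abs_two_minus_two_inner_eq_0\<close>).
\<close>

text \<open>
  Each row of the kernel has one diagonal entry and \<open>card A - 1\<close> others, so its sum is at most
  \<open>a - (card A - 1) c\<close>. This bound is the same for every row, so it cannot be negative when
  the total is not.
\<close>
lemma card_le_of_sum_kernel_nonneg: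
  fixes F :: "'a \<Rightarrow> 'a \<Rightarrow> real" and a c :: real
  assumes "finite A" and "A \<noteq> {}" and "c > 0"
    and nonneg: "(\<Sum>x\<in>A. \<Sum>y\<in>A. F x y) \<ge> 0"
    and diag: "\<And>x. x \<in> A \<Longrightarrow> F x x \<le> a"
    and off_diag: "\<And>x y. x \<in> A \<Longrightarrow> y \<in> A \<Longrightarrow> x \<noteq> y \<Longrightarrow> F x y \<le> - c"
  shows "real (card A) \<le> (a + c) / c"
proof -
  have card_pos: "card A > 0"
    using assms by (simp add: card_gt_0_iff)
  have row: "(\<Sum>y\<in>A. F x y) \<le> a - (real (card A) - 1) * c" if x: "x \<in> A" for x
  proof -
    have "(\<Sum>y\<in>A. F x y) = F x x + (\<Sum>y\<in>A - {x}. F x y)"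
      by (rule sum.remove[OF \<open>finite A\<close> x])
    also have "\<dots> \<le> a + (\<Sum>y\<in>A - {x}. - c)"
      using x by (intro add_mono sum_mono diag off_diag) auto
    also have "(\<Sum>y\<in>A - {x}. - c) = - (real (card A) - 1) * c"
      using card_pos x by (simp add: card_Diff_singleton of_nat_diff algebra_simps)
    finally show ?thesis by (simp add: algebra_simps)
  qed
  have "0 \<le> (\<Sum>x\<in>A. a - (real (card A) - 1) * c)"
    using nonneg by (rule order_trans) (intro sum_mono row)
  hence "0 \<le> a - (real (card A) - 1) * c"
    using card_pos by (simp add: zero_le_mult_iff)
  thus ?thesis
    using \<open>c > 0\<close> by (simp add: field_simps)
qed

lemma padic_abs_zero:
  assumes p: "prime p"
  shows "padic_abs p \<zero>\<^bsub>Qp p\<^esub> = 0"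
proof -
  interpret I: ideal "padic_null p" "padic_Cauchy_ring p"
    by (rule padic_null_ideal[OF p])
  have "padic_null p +>\<^bsub>padic_Cauchy_ring p\<^esub> (\<lambda>n. 0) = padic_null p"
    using I.a_rcos_const[OF additive_subgroup.zero_closed[OF I.is_additive_subgroup]]
    by (simp add: padic_Cauchy_ring_simps)
  hence "\<zero>\<^bsub>Qp p\<^esub> = padic_null p +>\<^bsub>padic_Cauchy_ring p\<^esub> (\<lambda>n. 0)"
    by (simp add: Qp_def FactRing_def)
  thus ?thesis
    by (simp add: padic_abs_of_rat[OF p])
qed

lemma abs_two_minus_two_inner_eq_0:
  assumes p: "prime p" and unit: "padic_inner p d x y = \<one>\<^bsub>Qp p\<^esub>"
  shows "abs_two_minus_two_inner p d x y = 0"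
proof -
  interpret field "Qp p" by (rule Qp_field[OF p])
  show ?thesis
    by (simp add: abs_two_minus_two_inner_def unit padic_abs_zero[OF p] r_neg minus_eq)
qed

theorem theorem2p4:
  fixes p d n :: nat and \<theta> c :: real
    and \<tau> :: "nat \<Rightarrow> nat \<Rightarrow> padic"
    and \<phi> :: "real \<Rightarrow> real"
  assumes "prime p" and "d \<ge> 1" and "n \<ge> 1"
    and "0 \<le> \<theta>" and "\<theta> < 2 * pi"
    and "padic_spherical_code p d n \<theta> \<tau>"
    and "c > 0"
    and "(\<Sum>j\<in>{1..n}. \<Sum>k\<in>{1..n}. \<phi> (abs_two_minus_two_inner p d (\<tau> j) (\<tau> k))) \<ge> 0"
    and "\<forall>r \<ge> 2 * (1 - cos \<theta>). \<phi> r + c \<le> 0"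
  shows "real n \<le> (\<phi> 0 + c) / c \<and> (\<phi> 0 + c \<le> 1 \<longrightarrow> real n \<le> 1 / c)"
proof -
  define F where "F = (\<lambda>j k. \<phi> (abs_two_minus_two_inner p d (\<tau> j) (\<tau> k)))"
  have diag: "F j j \<le> \<phi> 0" if "j \<in> {1..n}" for j
  proof -
    have "padic_inner p d (\<tau> j) (\<tau> j) = \<one>\<^bsub>Qp p\<^esub>"
      using assms(6) that by (simp add: padic_spherical_code_def)
    thus ?thesis
      by (simp add: F_def abs_two_minus_two_inner_eq_0[OF assms(1)])
  qed
  have off_diag: "F j k \<le> - c" if "j \<in> {1..n}" "k \<in> {1..n}" "j \<noteq> k" for j k
  proof -
    have "abs_two_minus_two_inner p d (\<tau> j) (\<tau> k) \<ge> 2 * (1 - cos \<theta>)"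
      using assms(6) that unfolding padic_spherical_code_def by blast
    hence "F j k + c \<le> 0"
      using assms(9) unfolding F_def by blast
    thus ?thesis by simp
  qed
  have bound: "real n \<le> (\<phi> 0 + c) / c"
    using card_le_of_sum_kernel_nonneg[of "{1..n}" c F "\<phi> 0"] assms(3,7,8) diag off_diag
    by (simp add: F_def)
  moreover have "real n \<le> 1 / c" if "\<phi> 0 + c \<le> 1"
    using bound divide_right_mono[OF that, of c] \<open>c > 0\<close> by linarith
  ultimately show ?thesis by blast
qed

end
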